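(* Let $D$ be a loose multipartite tournament of order $n$ with no sinks. If $S$ is an anti-$\{1,2\}$-competing set of $D$ that is not contained in any single partite set of $D$, then $|S|\le 4$. Moreover, if $|S|=4$, then: (1) there exist two partite sets $X_1,X_2$ of $D$ with $|S\cap X_1|=|S\cap X_2|=2$; (2) $n\ge 5$ and $C_{1,2}(D)$ is isomorphic to $K_n-E(K_4)$, the complete graph on $n$ vertices with the edges of a $4$-vertex clique removed.
   Context: All graphs and digraphs are finite and simple. For a digraph $D$, a sink is a vertex of outdegree $0$; $d_D(x,y)$ is the length of a shortest directed path from $x$ to $y$. The $(1,2)$-step competition graph $C_{1,2}(D)$ is the graph on $V(D)$ in which distinct $u,v$ are adjacent iff there is a vertex $w\notin\{u,v\}$ with either $d_{D-v}(u,w)\le 1$ and $d_{D-u}(v,w)\le 2$, or $d_{D-u}(v,w)\le 1$ and $d_{D-v}(u,w)\le 2$. A multipartite tournament is an orientation of a complete $k$-partite graph for some $k\ge3$ (with nonempty partite sets). A set of vertices is $\{1,2\}$-competing if it is a clique in $C_{1,2}(D)$, anti-$\{1,2\}$-competing if it is a stable set in $C_{1,2}(D)$. A multipartite tournament is loose if some partite set is not $\{1,2\}$-competing. *)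

theory Defs
  imports
    "Graph_Theory.Kuratowski"
    "Graph_Theory.Digraph_Isomorphism"
    "HOL-Library.Disjoint_Sets"
    "HOL-Library.Extended_Nat"
begin

text \<open>
  Undirected graphs are represented, as usual in this library, by symmetric digraphs:
  an edge \<open>uv\<close> is the pair of arcs \<open>(u,v)\<close>, \<open>(v,u)\<close>.
\<close>

definition sink :: "('a,'b) pre_digraph \<Rightarrow> 'a \<Rightarrow> bool" where
  "sink D v \<longleftrightarrow> v \<in> verts D \<and> out_degree D v = 0"

text \<open>The distance is \<open>\<infinity>\<close> if there is no directed path from \<open>x\<close> to \<open>y\<close>.\<close>

definition ddist :: "('a,'b) pre_digraph \<Rightarrow> 'a \<Rightarrow> 'a \<Rightarrow> enat" where
  "ddist D x y = (INF p \<in> {p. pre_digraph.apath D x p y}. enat (length p))"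

definition competition_graph12 :: "('a,'b) pre_digraph \<Rightarrow> 'a pair_pre_digraph" where
  "competition_graph12 D = \<lparr> pverts = verts D,
     parcs = {(u, v). u \<in> verts D \<and> v \<in> verts D \<and> u \<noteq> v \<and>
       (\<exists>w \<in> verts D - {u, v}.
          (ddist (pre_digraph.del_vert D v) u w \<le> 1 \<and> ddist (pre_digraph.del_vert D u) v w \<le> 2) \<or>
          (ddist (pre_digraph.del_vert D u) v w \<le> 1 \<and> ddist (pre_digraph.del_vert D v) u w \<le> 2))} \<rparr>"

definition clique :: "('a,'b) pre_digraph \<Rightarrow> 'a set \<Rightarrow> bool" where
  "clique G S \<longleftrightarrow> S \<subseteq> verts G \<and> (\<forall>u\<in>S. \<forall>v\<in>S. u \<noteq> v \<longrightarrow> u \<rightarrow>\<^bsub>G\<^esub> v)"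

definition stable_set :: "('a,'b) pre_digraph \<Rightarrow> 'a set \<Rightarrow> bool" where
  "stable_set G S \<longleftrightarrow> S \<subseteq> verts G \<and> (\<forall>u\<in>S. \<forall>v\<in>S. u \<noteq> v \<longrightarrow> \<not> u \<rightarrow>\<^bsub>G\<^esub> v)"

definition competing12 :: "('a,'b) pre_digraph \<Rightarrow> 'a set \<Rightarrow> bool" where
  "competing12 D S \<longleftrightarrow> clique (competition_graph12 D) S"

definition anti_competing12 :: "('a,'b) pre_digraph \<Rightarrow> 'a set \<Rightarrow> bool" where
  "anti_competing12 D S \<longleftrightarrow> stable_set (competition_graph12 D) S"

definition complete_multipartite :: "'a set set \<Rightarrow> 'a pair_pre_digraph" where
  "complete_multipartite P = \<lparr> pverts = \<Union>P,
     parcs = {(u, v). \<exists>X\<in>P. \<exists>Y\<in>P. X \<noteq> Y \<and> u \<in> X \<and> v \<in> Y} \<rparr>"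

definition orientation_of :: "('a,'b) pre_digraph \<Rightarrow> ('a,'c) pre_digraph \<Rightarrow> bool" where
  "orientation_of D G \<longleftrightarrow> digraph D \<and> verts D = verts G \<and>
     (\<forall>u v. u \<rightarrow>\<^bsub>G\<^esub> v \<longleftrightarrow> u \<rightarrow>\<^bsub>D\<^esub> v \<or> v \<rightarrow>\<^bsub>D\<^esub> u) \<and>
     (\<forall>u v. \<not> (u \<rightarrow>\<^bsub>D\<^esub> v \<and> v \<rightarrow>\<^bsub>D\<^esub> u))"

text \<open>
  \<open>P\<close> is the collection of partite sets; \<^const>\<open>partition_on\<close> makes them nonempty and
  disjoint. It is determined by \<open>D\<close>, two vertices lying in the same partite set iff
  no arc joins them.
\<close>

definition multipartite_tournament :: "('a,'b) pre_digraph \<Rightarrow> 'a set set \<Rightarrow> bool" where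
  "multipartite_tournament D P \<longleftrightarrow>
     partition_on (verts D) P \<and> card P \<ge> 3 \<and> orientation_of D (complete_multipartite P)"

definition loose_multipartite_tournament :: "('a,'b) pre_digraph \<Rightarrow> 'a set set \<Rightarrow> bool" where
  "loose_multipartite_tournament D P \<longleftrightarrow>
     multipartite_tournament D P \<and> (\<exists>X\<in>P. \<not> competing12 D X)"

definition complete_graph_on :: "'a set \<Rightarrow> 'a pair_pre_digraph" where
  "complete_graph_on V = \<lparr> pverts = V, parcs = {(u, v). u \<in> V \<and> v \<in> V \<and> u \<noteq> v} \<rparr>"

lemma complete_digraph_complete_graph_on:
  "finite V \<Longrightarrow> complete_digraph (card V) (complete_graph_on V)"
  by (auto simp: complete_digraph_pair_def complete_graph_on_def)

text \<open>\<open>K\<^sub>n - E(K\<^sub>4)\<close> on the vertices \<open>0, \<dots>, n - 1\<close>; meaningful for \<open>n \<ge> 4\<close>.\<close>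

definition complete_minus_K4 :: "nat \<Rightarrow> nat pair_pre_digraph" where
  "complete_minus_K4 n = \<lparr> pverts = {..<n},
     parcs = parcs (complete_graph_on {..<n}) - parcs (complete_graph_on {..<4}) \<rparr>"

end

theory Submission
  imports Defs
begin

text \<open>
  If two vertices \<open>u\<close>, \<open>v\<close> do not compete, then their out-neighbourhoods, apart from \<open>u\<close> and \<open>v\<close>
  themselves, are disjoint and no arc joins them, so together they lie in one partite set as soon
  as both are nonempty. For two vertices of the same partite set this means that every vertex
  outside this set dominates one of them. Looseness provides such a pair \<open>x\<^sub>1\<close>, \<open>x\<^sub>2\<close> in a partite
  set \<open>X\<close>. By the pigeonhole principle at most two members of \<open>S\<close> lie outside \<open>X\<close>; and a member
  of \<open>S\<close> outside \<open>X\<close> dominates at most one member of \<open>S\<close> in \<open>X\<close> and is dominated by at most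
  one, so at most two lie in \<open>X\<close>. In the extremal case the four vertices form a directed cycle
  in which each vertex has only its successor as out-neighbour, and hence is dominated by all
  other vertices outside its partite set; this makes all remaining pairs compete.
\<close>

text \<open>The predicate \<open>Q\<close>, read as a map into the two-element type
  \<open>bool\<close>, is injective on \<open>A\<close>: where it fails, \<open>R\<close> holds.
  Finiteness is included because \<open>card\<close> is 0 on infinite sets.\<close>

lemma card_le_2_if_covered_by_unique:
  assumes "\<And>x. x \<in> A \<Longrightarrow> Q x \<or> R x"
    and "\<And>x y. x \<in> A \<Longrightarrow> y \<in> A \<Longrightarrow> Q x \<Longrightarrow> Q y \<Longrightarrow> x = y"
    and "\<And>x y. x \<in> A \<Longrightarrow> y \<in> A \<Longrightarrow> R x \<Longrightarrow> R y \<Longrightarrow> x = y"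
  shows "finite A \<and> card A \<le> 2"
proof -
  have inj: "inj_on Q A" using assms by (intro inj_onI) metis
  show ?thesis using inj_on_finite[OF inj, of UNIV] card_inj_on_le[OF inj, of UNIV] by simp
qed

section \<open>Non-competing pairs in a multipartite tournament without sinks\<close>

locale sinkless_multipartite_tournament =
  fixes V :: "'a set" and E :: "'a \<Rightarrow> 'a \<Rightarrow> bool" and part :: "'a \<Rightarrow> 'c"
  assumes arc_iff: "E u v \<or> E v u \<longleftrightarrow> u \<in> V \<and> v \<in> V \<and> part u \<noteq> part v"
    and asym: "E u v \<Longrightarrow> \<not> E v u"
    and no_sink: "v \<in> V \<Longrightarrow> \<exists>w. E v w"
begin

text \<open>This is adjacency in the (1,2)-step competition graph with distances unfolded: deleting
  the other vertex means that the middle vertex \<open>x\<close> of a two-arc path must avoid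
  it.\<close>

definition competes :: "'a \<Rightarrow> 'a \<Rightarrow> bool" where
  "competes u v \<longleftrightarrow> (\<exists>w. w \<noteq> u \<and> w \<noteq> v \<and>
     (E u w \<and> (E v w \<or> (\<exists>x. x \<noteq> u \<and> E v x \<and> E x w)) \<or>
      E v w \<and> (E u w \<or> (\<exists>x. x \<noteq> v \<and> E u x \<and> E x w))))"

lemma arcD: assumes "E u v" shows "u \<in> V" "v \<in> V" "part u \<noteq> part v" "u \<noteq> v"
  using arc_iff[of u v] assms by auto

lemma competes_commute: "competes u v \<longleftrightarrow> competes v u"
  unfolding competes_def by blast

lemma competes_commonI: "E u w \<Longrightarrow> E v w \<Longrightarrow> competes u v"
  unfolding competes_def by (intro exI[of _ w]) (auto dest: arcD(4))

lemma competes_two_stepI: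
  "E u w \<Longrightarrow> E v x \<Longrightarrow> E x w \<Longrightarrow> x \<noteq> u \<Longrightarrow> v \<noteq> w \<Longrightarrow> competes u v"
  unfolding competes_def by (intro exI[of _ w]) (auto dest: arcD(4))

text \<open>An arc from \<open>b\<close> to \<open>a\<close> would let \<open>u\<close> reach
  \<open>a\<close> in one step and \<open>v\<close> reach it in two; an arc from \<open>a\<close> to
  \<open>b\<close> does the same with the roles exchanged. Distinct vertices joined by no arc share
  a partite set.\<close>

lemma not_competes_out:
  assumes "\<not> competes u v" "E u a" "a \<noteq> v" "E v b" "b \<noteq> u"
  shows "a \<noteq> b" "part a = part b"
proof -
  show "a \<noteq> b" using assms competes_commonI by blast
  have "\<not> E b a" using assms competes_two_stepI[of u a v b] by blast
  moreover have "\<not> E a b" using assms competes_two_stepI[of v b u a] competes_commute by blast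
  ultimately show "part a = part b" using arc_iff[of a b] arcD assms by blast
qed

text \<open>Otherwise both vertices would dominate \<open>w\<close>.\<close>

lemma not_competes_same_part:
  assumes "u \<in> V" "v \<in> V" "part u = part v" "\<not> competes u v" "w \<in> V" "part w \<noteq> part u"
  shows "E w u \<or> E w v"
  using assms competes_commonI arc_iff[of w u] arc_iff[of w v] by metis

lemma not_competes_same_part_out:
  assumes "part u = part v" "\<not> competes u v" "E u a" "E v b"
  shows "part a = part b"
proof (rule not_competes_out(2))
  show "a \<noteq> v" "b \<noteq> u" using assms arcD(3) by metis+
qed (use assms in auto)

text \<open>The point is that \<open>y\<close> dominates exactly one of \<open>x\<close> and
  \<open>x'\<close>. If it dominated both, then \<open>x'\<close> and any out-neighbour
  \<open>b\<close> of \<open>x\<close> would be out-neighbours of the non-competing pair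
  \<open>y\<close>, \<open>x\<close>, so \<open>b\<close> would lie in the partite set of
  \<open>x\<close>.\<close>

lemma stable_triple_dominates_one:
  assumes "x \<in> V" "x' \<in> V" "y \<in> V" "part x = part x'" "part y \<noteq> part x" "x \<noteq> x'"
    and "\<not> competes x x'" "\<not> competes y x"
  shows "E y x \<longleftrightarrow> E x' y"
proof -
  obtain b where b: "E x b" using no_sink assms by blast
  have "\<not> (E y x \<and> E y x')"
    using not_competes_out(2)[of y x x' b] b assms arcD(3)[OF b] asym by metis
  moreover have "E y x \<or> E y x'"
    using not_competes_same_part assms by blast
  ultimately show ?thesis using arc_iff[of x' y] asym assms by metis
qed

text \<open>A second out-neighbour of \<open>u\<close> would share the partite set of
  \<open>t\<close>, which is that of \<open>u\<close> itself.\<close>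

lemma out_neighbour_unique:
  assumes "E u v" "E v t" "\<not> competes u v" "part t = part u" "t \<noteq> u" "E u w"
  shows "w = v"
  using not_competes_out(2)[of u v w t] assms arcD(3) by metis

section \<open>Size and shape of a stable set\<close>

lemma stable_set_bound:
  assumes x: "x1 \<in> V" "x2 \<in> V" "part x1 = part x2" "\<not> competes x1 x2"
    and S: "S \<subseteq> V" "\<And>u v. u \<in> S \<Longrightarrow> v \<in> S \<Longrightarrow> u \<noteq> v \<Longrightarrow> \<not> competes u v"
    and st: "s \<in> S" "t \<in> S" "part s \<noteq> part t"
  obtains q where "finite S" "card S \<le> 4"
    "card S = 4 \<Longrightarrow> q \<noteq> part x1 \<and> card {s \<in> S. part s = part x1} = 2 \<and>
       card {s \<in> S. part s = q} = 2 \<and> (\<forall>s \<in> S. part s \<in> {part x1, q})"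
proof -
  define A where "A = {s \<in> S. part s = part x1}"
  define B where "B = {s \<in> S. part s \<noteq> part x1}"
  have AB: "S = A \<union> B" "A \<inter> B = {}" unfolding A_def B_def by auto
  obtain y where y: "y \<in> S" "part y \<noteq> part x1" using st by metis
  have A: "finite A \<and> card A \<le> 2"
  proof (rule card_le_2_if_covered_by_unique[where Q = "E y" and R = "\<lambda>x. E x y"])
    fix x assume "x \<in> A"
    then show "E y x \<or> E x y" using arc_iff[of y x] y S unfolding A_def by auto
  next
    fix x x' assume "x \<in> A" "x' \<in> A" "E y x" "E y x'"
    then show "x = x'"
      using stable_triple_dominates_one[of x x' y] y S asym unfolding A_def by (auto dest: asym)
  next
    fix x x' assume "x \<in> A" "x' \<in> A" "E x y" "E x' y"
    then show "x = x'"
      using competes_commonI[of x y x'] S(2)[of x x'] unfolding A_def by auto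
  qed
  have B: "finite B \<and> card B \<le> 2"
  proof (rule card_le_2_if_covered_by_unique[where Q = "\<lambda>s. E s x1" and R = "\<lambda>s. E s x2"])
    fix s assume "s \<in> B"
    then show "E s x1 \<or> E s x2"
      using not_competes_same_part[of x1 x2 s] x S unfolding B_def by auto
  next
    fix s t assume "s \<in> B" "t \<in> B" "E s x1" "E t x1"
    then show "s = t" using competes_commonI[of s x1 t] S(2)[of s t] unfolding B_def by auto
  next
    fix s t assume "s \<in> B" "t \<in> B" "E s x2" "E t x2"
    then show "s = t" using competes_commonI[of s x2 t] S(2)[of s t] unfolding B_def by auto
  qed
  obtain a where a: "E x1 a" using no_sink x by blast
  \<comment> \<open>One of \<open>x1\<close>, \<open>x2\<close> dominates \<open>s\<close>:
    otherwise \<open>s\<close> dominates both, and the other element of \<open>B\<close> dominates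
    one of them, which makes these two compete. All out-neighbours of \<open>x1\<close> and
    \<open>x2\<close> lie in one partite set, that of \<open>a\<close>.\<close>
  have part_B: "part s = part a" if "s \<in> B" "card B = 2" for s
  proof -
    have "\<exists>t\<in>B. t \<noteq> s"
      using that by (auto simp: card_2_iff)
    then obtain t where t: "t \<in> B" "t \<noteq> s" by blast
    have ns: "\<not> competes s t" using t that S(2)[of s t] unfolding B_def by auto
    obtain b where b: "E x2 b" using no_sink x by blast
    have "E x1 s \<or> E x2 s"
    proof (rule ccontr)
      assume "\<not> ?thesis"
      then have "E s x1" "E s x2"
        using that arc_iff[of s x1] arc_iff[of s x2] x S(1) unfolding B_def by auto
      moreover have "E t x1 \<or> E t x2"
        using not_competes_same_part[of x1 x2 t] x S(1) t unfolding B_def by auto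
      ultimately show False using ns competes_commonI by blast
    qed
    then show ?thesis
      using not_competes_same_part_out[of x1 x2] x a b by metis
  qed
  have card: "card S = card A + card B" using AB A B by (simp add: card_Un_disjoint)
  show thesis
  proof (rule that[of "part a"])
    show "finite S" "card S \<le> 4" using AB A B card by auto
    assume "card S = 4"
    then have c: "card A = 2" "card B = 2" using card A B by linarith+
    moreover have "{s \<in> S. part s = part a} = B"
      using part_B c arcD(3)[OF a] unfolding B_def by auto
    moreover have "\<forall>s \<in> S. part s \<in> {part x1, part a}"
      using part_B c unfolding B_def by auto
    ultimately show "part a \<noteq> part x1 \<and> card {s \<in> S. part s = part x1} = 2 \<and>
       card {s \<in> S. part s = part a} = 2 \<and> (\<forall>s \<in> S. part s \<in> {part x1, part a})"
      using arcD(3)[OF a] unfolding A_def by auto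
  qed
qed

section \<open>Competition around a directed four-cycle\<close>

text \<open>The vertex \<open>u\<close> dominates both \<open>a\<close> and \<open>c\<close>, so it
  suffices that \<open>v\<close> reaches one of them suitably: directly if it lies outside their
  partite set, through \<open>b\<close> to \<open>c\<close> if it is \<open>a\<close>, and through
  \<open>d\<close> to \<open>a\<close> otherwise.\<close>

lemma competes_of_four_cycle_aux:
  assumes out: "\<And>w. E a w \<longleftrightarrow> w = b" "\<And>w. E b w \<longleftrightarrow> w = c"
      "\<And>w. E c w \<longleftrightarrow> w = d" "\<And>w. E d w \<longleftrightarrow> w = a"
    and parts: "part a = part c" "part b = part d" "a \<noteq> c"
    and u: "u \<in> V" "u \<notin> {a, b, c, d}" "part u \<noteq> part a" and v: "v \<in> V" "v \<noteq> u"
  shows "competes u v"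
proof -
  have E: "E a b" "E b c" "E c d" "E d a" using out by auto
  have V: "a \<in> V" "b \<in> V" "c \<in> V" "d \<in> V" and ab: "part a \<noteq> part b" using E arcD by blast+
  have dom_a: "E w a" if "w \<in> V" "part w \<noteq> part a" "w \<noteq> b" for w
    using arc_iff[of a w] out(1)[of w] that V by auto
  have dom_c: "E w c" if "w \<in> V" "part w \<noteq> part a" "w \<noteq> d" for w
    using arc_iff[of c w] out(3)[of w] that V parts by auto
  have dom_d: "E w d" if "w \<in> V" "part w = part a" "w \<noteq> a" for w
    using arc_iff[of d w] out(4)[of w] that V ab parts by auto
  have u': "E u a" "E u c" using dom_a dom_c u by auto
  show ?thesis
  proof (cases "part v = part a")
    case False
    then have "E v a \<or> E v c" using dom_a[of v] dom_c[of v] v E by auto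
    then show ?thesis using u' competes_commonI by blast
  next
    case True
    show ?thesis
    proof (cases "v = a")
      case True
      then show ?thesis
        using competes_two_stepI[of u c v b] u' E u parts by auto
    next
      case False
      then show ?thesis
        using competes_two_stepI[of u a v d] u' E u dom_d[of v] v True by auto
    qed
  qed
qed

text \<open>
  The hypotheses are invariant under rotation of the cycle, so the vertex outside \<open>{a, b, c, d}\<close>
  may be taken outside the partite set of \<open>a\<close> and \<open>c\<close>.
\<close>

lemma competes_of_four_cycle:
  assumes out: "\<And>w. E a w \<longleftrightarrow> w = b" "\<And>w. E b w \<longleftrightarrow> w = c"
      "\<And>w. E c w \<longleftrightarrow> w = d" "\<And>w. E d w \<longleftrightarrow> w = a"
    and parts: "part a = part c" "part b = part d" "a \<noteq> c" "b \<noteq> d"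
    and uv: "u \<in> V" "u \<notin> {a, b, c, d}" "v \<in> V" "v \<noteq> u"
  shows "competes u v"
proof (cases "part u = part a")
  case True
  then have "part u \<noteq> part b" using out arcD(3) by metis
  then show ?thesis
    using competes_of_four_cycle_aux[of b c d a] assms by auto
qed (use competes_of_four_cycle_aux[of a b c d] assms in auto)

lemma competes_of_stable_four_set:
  assumes S: "S \<subseteq> V" "\<And>u v. u \<in> S \<Longrightarrow> v \<in> S \<Longrightarrow> u \<noteq> v \<Longrightarrow> \<not> competes u v"
    and pq: "p \<noteq> q" "card {s \<in> S. part s = p} = 2" "card {s \<in> S. part s = q} = 2"
      "\<forall>s \<in> S. part s \<in> {p, q}"
    and uv: "u \<in> V" "v \<in> V" "u \<noteq> v" "\<not> (u \<in> S \<and> v \<in> S)"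
  shows "competes u v"
proof -
  obtain a c where ac: "{s \<in> S. part s = p} = {a, c}" "a \<noteq> c" using pq by (metis card_2_iff)
  \<comment> \<open>As \<open>b\<close> and \<open>d\<close> do not compete, \<open>a\<close>
    dominates one of them; the names are chosen so that it is \<open>b\<close>.\<close>
  obtain b d where bd: "{s \<in> S. part s = q} = {b, d}" "b \<noteq> d" "E a b"
  proof -
    obtain b d where bd: "{s \<in> S. part s = q} = {b, d}" "b \<noteq> d" using pq by (metis card_2_iff)
    have "b \<in> S" "d \<in> S" "part b = q" "part d = q" "a \<in> S" "part a = p" using ac bd by auto
    then have "E a b \<or> E a d"
      using not_competes_same_part[of b d a] S(1) S(2)[of b d] bd(2) pq(1) by auto
    then show thesis using that[of b d] that[of d b] bd by (auto simp: insert_commute)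
  qed
  have p: "part a = p" "part c = p" "part b = q" "part d = q" using ac bd by auto
  have SS: "S = {a, b, c, d}" using ac(1) bd(1) pq(4) by blast
  have V: "a \<in> V" "b \<in> V" "c \<in> V" "d \<in> V" using SS S by auto
  have nc: "\<not> competes a b" "\<not> competes b c" "\<not> competes c d" "\<not> competes d a"
    "\<not> competes a c" "\<not> competes b d"
    by (rule S(2); use SS ac(2) bd(2) p pq(1) in force)+
  \<comment> \<open>The single arc from \<open>a\<close> to \<open>b\<close> forces the whole cycle:
    it yields the arcs from \<open>d\<close> to \<open>a\<close> and from \<open>b\<close> to
    \<open>c\<close>, and the latter yields the arc from \<open>c\<close> to
    \<open>d\<close>.\<close>
  have "E d a" using stable_triple_dominates_one[of b d a] V p nc bd pq by auto
  moreover have "E b c" using stable_triple_dominates_one[of c a b] V p nc bd pq ac competes_commute by auto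
  moreover have "E c d" using stable_triple_dominates_one[of d b c] V p nc \<open>E b c\<close> bd pq competes_commute by auto
  ultimately have E: "E a b" "E b c" "E c d" "E d a" using bd by auto
  have out: "E a w \<longleftrightarrow> w = b" "E b w \<longleftrightarrow> w = c" "E c w \<longleftrightarrow> w = d" "E d w \<longleftrightarrow> w = a" for w
    using out_neighbour_unique[of a b c w] out_neighbour_unique[of b c d w]
      out_neighbour_unique[of c d a w] out_neighbour_unique[of d a b w] E nc p ac bd by auto
  show ?thesis
  proof (cases "u \<in> S")
    case False
    then show ?thesis using competes_of_four_cycle[of a b c d u v] out p ac bd uv SS by auto
  next
    case True
    then have "competes v u"
      using competes_of_four_cycle[of a b c d v u] out p ac bd uv SS by auto
    then show ?thesis using competes_commute by blast
  qed
qed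

end

section \<open>From arcs to distances and the competition graph\<close>

lemma ddist_le_1:
  assumes "wf_digraph G" "u \<rightarrow>\<^bsub>G\<^esub> w" "u \<noteq> w"
  shows "ddist G u w \<le> 1"
proof -
  interpret wf_digraph G by fact
  obtain e where "e \<in> arcs G" "tail G e = u" "head G e = w"
    using assms by (auto simp: arcs_ends_conv)
  then have "apath u [e] w" using assms by (auto simp: apath_simps)
  then show ?thesis unfolding ddist_def by (intro INF_lower2[of "[e]"]) (auto simp: one_enat_def)
qed

lemma ddist_le_2:
  assumes "wf_digraph G" "u \<rightarrow>\<^bsub>G\<^esub> x" "x \<rightarrow>\<^bsub>G\<^esub> w" "u \<noteq> x" "x \<noteq> w" "u \<noteq> w"
  shows "ddist G u w \<le> 2"
proof -
  interpret wf_digraph G by fact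
  obtain e f where "e \<in> arcs G" "tail G e = u" "head G e = x" "f \<in> arcs G" "tail G f = x" "head G f = w"
    using assms by (auto simp: arcs_ends_conv)
  then have "apath u [e, f] w" using assms by (auto simp: apath_simps)
  then show ?thesis
    unfolding ddist_def by (intro INF_lower2[of "[e, f]"]) (auto simp: numeral_eq_enat)
qed

lemma dominates_del_vert:
  "u \<rightarrow>\<^bsub>pre_digraph.del_vert G v\<^esub> w \<longleftrightarrow> u \<rightarrow>\<^bsub>G\<^esub> w \<and> u \<noteq> v \<and> w \<noteq> v"
  by (auto simp: arcs_ends_conv pre_digraph.del_vert_simps)

text \<open>Here \<open>u\<close> takes the single step; exchanging \<open>u\<close> and
  \<open>v\<close> covers the other alternative, which is why both orientations of the edge are
  concluded.\<close>

lemma competition_graph12_arcI: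
  assumes "digraph D" "u \<in> verts D" "v \<in> verts D" "u \<noteq> v" "w \<noteq> u" "w \<noteq> v"
    and "u \<rightarrow>\<^bsub>D\<^esub> w" "v \<rightarrow>\<^bsub>D\<^esub> w \<or> (\<exists>x. x \<noteq> u \<and> v \<rightarrow>\<^bsub>D\<^esub> x \<and> x \<rightarrow>\<^bsub>D\<^esub> w)"
  shows "(u, v) \<in> parcs (competition_graph12 D)" "(v, u) \<in> parcs (competition_graph12 D)"
proof -
  interpret digraph D by fact
  \<comment> \<open>\<open>ddist\<close> ranges over paths without repeated vertices, so the
    vertices of the two-arc path have to be distinct.\<close>
  have loop: "x \<noteq> y" if "x \<rightarrow>\<^bsub>D\<^esub> y" for x y
    using that no_loops by (auto simp: arcs_ends_conv)
  have w: "w \<in> verts D - {u, v}" using assms by (auto simp: arcs_ends_conv)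
  have 1: "ddist (del_vert v) u w \<le> 1"
    using assms by (intro ddist_le_1 wf_digraph_del_vert) (auto simp: dominates_del_vert)
  have 2: "ddist (del_vert u) v w \<le> 2"
    using assms(8)
  proof
    assume "v \<rightarrow>\<^bsub>D\<^esub> w"
    then have "ddist (del_vert u) v w \<le> 1"
      using assms by (intro ddist_le_1 wf_digraph_del_vert) (auto simp: dominates_del_vert)
    also have "(1 :: enat) \<le> 2" by (simp add: one_enat_def numeral_eq_enat)
    finally show ?thesis .
  next
    assume "\<exists>x. x \<noteq> u \<and> v \<rightarrow>\<^bsub>D\<^esub> x \<and> x \<rightarrow>\<^bsub>D\<^esub> w"
    then obtain x where "x \<noteq> u" "v \<rightarrow>\<^bsub>D\<^esub> x" "x \<rightarrow>\<^bsub>D\<^esub> w" by blast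
    then show ?thesis
      using assms loop
      by (intro ddist_le_2[of _ _ x] wf_digraph_del_vert) (auto simp: dominates_del_vert)
  qed
  show "(u, v) \<in> parcs (competition_graph12 D)" "(v, u) \<in> parcs (competition_graph12 D)"
    using assms(2-4) w 1 2 unfolding competition_graph12_def by auto
qed

section \<open>Isomorphism with the standard model\<close>

text \<open>An arc of a pair digraph is the pair of its ends, so the vertex bijection
  \<open>f\<close> determines the arc map \<open>map_prod f f\<close>.\<close>

lemma digraph_iso_with_projI:
  assumes "bij_betw f (pverts G) (pverts H)"
    and "\<And>u v. (u, v) \<in> parcs G \<Longrightarrow> u \<in> pverts G \<and> v \<in> pverts G"
    and "\<And>u v. (u, v) \<in> parcs H \<Longrightarrow> u \<in> pverts H \<and> v \<in> pverts H"
    and "\<And>u v. u \<in> pverts G \<Longrightarrow> v \<in> pverts G \<Longrightarrow> (f u, f v) \<in> parcs H \<longleftrightarrow> (u, v) \<in> parcs G"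
  shows "digraph_iso (with_proj G) (with_proj H)"
proof -
  let ?h = "\<lparr> iso_verts = f, iso_arcs = map_prod f f, iso_head = snd, iso_tail = fst \<rparr>"
  have inj: "inj_on f (pverts G)" and im: "f ` pverts G = pverts H"
    using assms(1) by (auto simp: bij_betw_def)
  have "wf_digraph (with_proj G)"
    by unfold_locales (use assms(2) in auto)
  moreover have "inj_on (map_prod f f) (parcs G)"
    using assms(2) inj by (auto simp: inj_on_def)
  ultimately have "pre_digraph.digraph_isomorphism (with_proj G) ?h"
    using inj by (auto simp: pre_digraph.digraph_isomorphism_def)
  moreover have "parcs H \<subseteq> map_prod f f ` parcs G"
  proof
    fix e assume e: "e \<in> parcs H"
    obtain x y where xy: "e = (x, y)" by (cases e)
    then obtain u v where "u \<in> pverts G" "v \<in> pverts G" "x = f u" "y = f v"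
      using assms(3) e im by blast
    then show "e \<in> map_prod f f ` parcs G"
      using assms(4)[of u v] e xy by (auto intro!: image_eqI[of _ _ "(u, v)"])
  qed
  moreover have "map_prod f f ` parcs G \<subseteq> parcs H"
    using assms(2,4) by auto
  ultimately show ?thesis
    unfolding digraph_iso_def using im
    by (intro exI[of _ ?h] conjI) (auto simp: app_iso_def with_proj_def)
qed

theorem theorem3p8:
  fixes D :: "('a,'b) pre_digraph" and P :: "'a set set" and S :: "'a set" and n :: nat
  assumes "loose_multipartite_tournament D P"
    and "card (verts D) = n"
    and "\<forall>v \<in> verts D. \<not> sink D v"
    and "anti_competing12 D S"
    and "\<not> (\<exists>X\<in>P. S \<subseteq> X)"
  shows "card S \<le> 4 \<and>
    (card S = 4 \<longrightarrow>
      (\<exists>X1\<in>P. \<exists>X2\<in>P. X1 \<noteq> X2 \<and> card (S \<inter> X1) = 2 \<and> card (S \<inter> X2) = 2) \<and>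
      n \<ge> 5 \<and> digraph_iso (competition_graph12 D) (complete_minus_K4 n))"
proof -
  let ?C = "competition_graph12 D"
  have part_on: "partition_on (verts D) P" and P3: "card P \<ge> 3"
    and ori: "orientation_of D (complete_multipartite P)"
    and loose: "\<exists>X\<in>P. \<not> competing12 D X"
    using assms(1) by (auto simp: loose_multipartite_tournament_def multipartite_tournament_def)
  interpret D: digraph D using ori by (simp add: orientation_of_def)
  have V: "verts D = \<Union>P" using part_on by (rule partition_onD1)
  then have "\<forall>v\<in>verts D. \<exists>X. X \<in> P \<and> v \<in> X" by blast
  then obtain part where part: "\<And>v. v \<in> verts D \<Longrightarrow> part v \<in> P \<and> v \<in> part v" by metis
  have part_eq: "part v = X" if "X \<in> P" "v \<in> X" for v X
    using that part[of v] V partition_onD2[OF part_on] by (auto simp: disjoint_def)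
  have arcs: "u \<rightarrow>\<^bsub>D\<^esub> v \<or> v \<rightarrow>\<^bsub>D\<^esub> u \<longleftrightarrow> u \<in> verts D \<and> v \<in> verts D \<and> part u \<noteq> part v" for u v
  proof -
    have "u \<rightarrow>\<^bsub>D\<^esub> v \<or> v \<rightarrow>\<^bsub>D\<^esub> u \<longleftrightarrow> (\<exists>X\<in>P. \<exists>Y\<in>P. X \<noteq> Y \<and> u \<in> X \<and> v \<in> Y)"
      using ori by (simp add: orientation_of_def complete_multipartite_def)
    also have "\<dots> \<longleftrightarrow> u \<in> verts D \<and> v \<in> verts D \<and> part u \<noteq> part v"
      using part part_eq V by (metis Union_iff)
    finally show ?thesis .
  qed
  interpret T: sinkless_multipartite_tournament "verts D" "dominates D" part
  proof
    show "u \<rightarrow>\<^bsub>D\<^esub> v \<or> v \<rightarrow>\<^bsub>D\<^esub> u \<longleftrightarrow> u \<in> verts D \<and> v \<in> verts D \<and> part u \<noteq> part v" for u v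
      by (rule arcs)
    show "u \<rightarrow>\<^bsub>D\<^esub> v \<Longrightarrow> \<not> v \<rightarrow>\<^bsub>D\<^esub> u" for u v
      using ori by (auto simp: orientation_of_def)
    fix v assume "v \<in> verts D"
    then have "out_arcs D v \<noteq> {}"
      using assms(3) by (auto simp: sink_def out_degree_def)
    then show "\<exists>w. v \<rightarrow>\<^bsub>D\<^esub> w" by (auto simp: out_arcs_def arcs_ends_conv)
  qed
  \<comment> \<open>This implication serves twice: its contrapositive turns missing edges of
    \<open>?C\<close> into non-competing pairs, and at the end it turns competing pairs into
    edges.\<close>
  have competesD: "(u, v) \<in> parcs ?C"
    if "T.competes u v" "u \<in> verts D" "v \<in> verts D" "u \<noteq> v" for u v
  proof -
    obtain w where "w \<noteq> u" "w \<noteq> v" and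
      "u \<rightarrow>\<^bsub>D\<^esub> w \<and> (v \<rightarrow>\<^bsub>D\<^esub> w \<or> (\<exists>x. x \<noteq> u \<and> v \<rightarrow>\<^bsub>D\<^esub> x \<and> x \<rightarrow>\<^bsub>D\<^esub> w)) \<or>
       v \<rightarrow>\<^bsub>D\<^esub> w \<and> (u \<rightarrow>\<^bsub>D\<^esub> w \<or> (\<exists>x. x \<noteq> v \<and> u \<rightarrow>\<^bsub>D\<^esub> x \<and> x \<rightarrow>\<^bsub>D\<^esub> w))"
      using \<open>T.competes u v\<close> unfolding T.competes_def by blast
    then show ?thesis
      using competition_graph12_arcI[OF D.digraph_axioms, of u v w]
        competition_graph12_arcI[OF D.digraph_axioms, of v u w] that by blast
  qed
  have SV: "S \<subseteq> verts D" and S_arc: "\<And>u v. u \<in> S \<Longrightarrow> v \<in> S \<Longrightarrow> u \<noteq> v \<Longrightarrow> (u, v) \<notin> parcs ?C"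
    using assms(4) by (auto simp: anti_competing12_def stable_set_def competition_graph12_def)
  have S: "\<not> T.competes u v" if "u \<in> S" "v \<in> S" "u \<noteq> v" for u v
    using competesD S_arc SV that by blast
  obtain X x1 x2 where X: "X \<in> P" "x1 \<in> X" "x2 \<in> X" "x1 \<noteq> x2" "(x1, x2) \<notin> parcs ?C"
  proof -
    obtain X where X: "X \<in> P" "\<not> competing12 D X" using loose by blast
    then have "X \<subseteq> pverts ?C" using V by (auto simp: competition_graph12_def)
    then show thesis using X that by (auto simp: competing12_def clique_def)
  qed
  have x: "x1 \<in> verts D" "x2 \<in> verts D" "part x1 = X" "part x2 = X" using X V part_eq by auto
  have nx: "\<not> T.competes x1 x2" using competesD X x by blast
  obtain s t where st: "s \<in> S" "t \<in> S" "part s \<noteq> part t"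
  proof -
    \<comment> \<open>An empty \<open>S\<close> would be contained in \<open>X\<close>.\<close>
    obtain s where s: "s \<in> S" using assms(5) X by blast
    then have "\<not> S \<subseteq> part s" using assms(5) part SV by blast
    then obtain t where "t \<in> S" "t \<notin> part s" by blast
    then show thesis using that s part SV by (metis subsetD)
  qed
  obtain Y where fin: "finite S" and le4: "card S \<le> 4"
    and eq4: "card S = 4 \<Longrightarrow> Y \<noteq> X \<and> card {s \<in> S. part s = X} = 2 \<and>
       card {s \<in> S. part s = Y} = 2 \<and> (\<forall>s \<in> S. part s \<in> {X, Y})"
    using T.stable_set_bound[OF x(1,2) _ nx SV S st] x by auto
  have "(\<exists>X1\<in>P. \<exists>X2\<in>P. X1 \<noteq> X2 \<and> card (S \<inter> X1) = 2 \<and> card (S \<inter> X2) = 2) \<and>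
      n \<ge> 5 \<and> digraph_iso ?C (complete_minus_K4 n)" if 4: "card S = 4"
  proof (intro conjI)
    note XY = eq4[OF 4]
    \<comment> \<open>So far \<open>Y\<close> is only a label; it is a partite set because some
      vertex of \<open>S\<close> carries it.\<close>
    then have "{s \<in> S. part s = Y} \<noteq> {}" by (metis card.empty zero_neq_numeral)
    then have Y: "Y \<in> P" using part SV by blast
    have inter: "{s \<in> S. part s = Z} = S \<inter> Z" if "Z \<in> P" for Z
      using that part part_eq SV by blast
    show "\<exists>X1\<in>P. \<exists>X2\<in>P. X1 \<noteq> X2 \<and> card (S \<inter> X1) = 2 \<and> card (S \<inter> X2) = 2"
      using XY Y X(1) inter by metis
    \<comment> \<open>The fifth vertex comes from a third partite set, which \<open>S\<close> does
      not meet.\<close>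
    have "\<not> P \<subseteq> {X, Y}"
    proof
      assume "P \<subseteq> {X, Y}"
      then have "card P \<le> card {X, Y}" by (intro card_mono) auto
      also have "\<dots> \<le> 2" by (simp add: card_insert_if)
      finally show False using P3 by simp
    qed
    then obtain Z where Z: "Z \<in> P" "Z \<noteq> X" "Z \<noteq> Y" by blast
    then obtain z where z: "z \<in> Z" using partition_onD3[OF part_on] by (metis equals0I)
    then have zS: "z \<notin> S" using XY part_eq[OF Z(1) z] Z by auto
    have "card (insert z S) \<le> card (verts D)"
      using z Z(1) V SV D.finite_verts by (intro card_mono) blast+
    then show n5: "n \<ge> 5" using 4 zS fin assms(2) by simp
    have arcs_C: "(u, v) \<in> parcs ?C \<longleftrightarrow> u \<noteq> v \<and> \<not> (u \<in> S \<and> v \<in> S)"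
      if "u \<in> verts D" "v \<in> verts D" for u v
    proof
      assume "(u, v) \<in> parcs ?C"
      then show "u \<noteq> v \<and> \<not> (u \<in> S \<and> v \<in> S)"
        using S_arc by (auto simp: competition_graph12_def)
    next
      assume "u \<noteq> v \<and> \<not> (u \<in> S \<and> v \<in> S)"
      then show "(u, v) \<in> parcs ?C"
        using T.competes_of_stable_four_set[OF SV S, of X Y u v] XY that competesD by blast
    qed
    \<comment> \<open>Numbering \<open>S\<close> by the numbers below 4 and the remaining vertices
      from 4 on sends \<open>S\<close> to the clique whose edges \<open>complete_minus_K4\<close>
      lacks.\<close>
    obtain g where g: "bij_betw g S {..<4::nat}"
      using finite_same_card_bij[OF fin, of "{..<4::nat}"] 4 by auto
    have "card (verts D - S) = card {4..<n}"
      using SV fin 4 assms(2) by (simp add: card_Diff_subset)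
    then obtain h where h: "bij_betw h (verts D - S) {4..<n}"
      using finite_same_card_bij[of "verts D - S" "{4..<n}"] by auto
    define f where "f v = (if v \<in> S then g v else h v)" for v
    have fS: "f v < 4 \<longleftrightarrow> v \<in> S" if "v \<in> verts D" for v
      using that bij_betw_apply[OF g, of v] bij_betw_apply[OF h, of v] by (auto simp: f_def)
    have "bij_betw f S {..<4}" "bij_betw f (verts D - S) {4..<n}"
      using g h bij_betw_cong[of S f g] bij_betw_cong[of "verts D - S" f h]
      by (auto simp: f_def)
    then have "bij_betw f (S \<union> (verts D - S)) ({..<4} \<union> {4..<n})"
      by (rule bij_betw_combine) auto
    moreover have "S \<union> (verts D - S) = verts D" "{..<4} \<union> {4..<n} = {..<n}"
      using SV n5 by auto
    ultimately have f: "bij_betw f (verts D) {..<n}" by simp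
    show "digraph_iso ?C (complete_minus_K4 n)"
    proof (rule digraph_iso_with_projI)
      show "bij_betw f (pverts ?C) (pverts (complete_minus_K4 n))"
        using f by (simp add: competition_graph12_def complete_minus_K4_def)
      fix u v assume "u \<in> pverts ?C" "v \<in> pverts ?C"
      then have uv: "u \<in> verts D" "v \<in> verts D" by (auto simp: competition_graph12_def)
      then have "f u < n" "f v < n" "f u = f v \<longleftrightarrow> u = v"
        using f by (auto simp: bij_betw_def inj_on_def)
      then show "(f u, f v) \<in> parcs (complete_minus_K4 n) \<longleftrightarrow> (u, v) \<in> parcs ?C"
        using arcs_C[OF uv] fS uv
        by (auto simp: complete_minus_K4_def complete_graph_on_def)
    qed (auto simp: competition_graph12_def complete_minus_K4_def complete_graph_on_def)
  qed
  then show ?thesis using le4 by blast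
qed

end
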